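(* Let $n\ge 1$, $r\ge 1$ and $k\ge 0$ be integers. Then $${G(n,r) \brace k + (r-1)n} = |F(r,n,k)| \qquad\text{and}\qquad {H(n,r) \brace k + (r-1)n} = |F(r,n,k)|.$$
   Context: Forests. An $r$-ary tree is a rooted tree in which every vertex (including the root) has some number $i$, $0\le i\le r$, of children, with the set of children of each vertex equipped with a bijection to some subset of $\{1,\ldots,r\}$ (so each child occupies one of $r$ distinguished slots, at most one child per slot). An $r$-ary forest is a forest in which each component is an $r$-ary tree (the components are not ordered). An increasing $r$-ary forest on $n$ vertices is an $r$-ary forest on $n$ vertices together with a bijection from its vertices to $\{1,\ldots,n\}$ such that the labels increase along any path starting from the root of a component. $F(r,n,k)$ is the set of increasing $r$-ary forests with $n$ vertices and $k$ components. Graphs. $G(n,r)$ is the graph obtained from the graph with no vertices by iterating $n$ times the following operation: add an isolated vertex, and then add, one after another, $r-1$ dominating vertices (a dominating vertex is a new vertex adjacent to all vertices present so far). $H(n,r)$ is the graph on vertex set $\{1,\ldots,rn\}$ in which two distinct vertices are adjacent if and only if both belong to the integer segment $\{i,i+1,\ldots,ir\}$ for some $1\le i\le n$. Graph Stirling numbers. For a graph $G$ and an integer $j\ge0$, ${G\brace j}$ is the number of partitions of the vertex set of $G$ into $j$ non-empty classes, none of which contains both endvertices of an edge of $G$. *)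

theory Defs
  imports "Graph_Theory.Pair_Digraph" "HOL-Library.Disjoint_Sets"
begin

section \<open>Graphs\<close>

text \<open>Finite simple graphs are represented as in the library locale \<open>pair_graph\<close>: the arc set is
  symmetric and irreflexive, an edge \<open>uv\<close> being the pair of arcs \<open>(u, v)\<close> and \<open>(v, u)\<close>.\<close>

definition graph_stirling :: "'a pair_pre_digraph \<Rightarrow> nat \<Rightarrow> nat" where
  "graph_stirling G j = card {P. partition_on (pverts G) P \<and> card P = j \<and>
     (\<forall>C\<in>P. \<forall>(u, v)\<in>parcs G. \<not> (u \<in> C \<and> v \<in> C))}"

definition empty_graph :: "nat pair_pre_digraph" where
  "empty_graph = \<lparr>pverts = {}, parcs = {}\<rparr>"

text \<open>Successively added vertices are named 1, 2, 3, and so on, so the name below is unused whenever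
  the vertex set is \<open>{1..m}\<close>, as it is throughout the construction of \<open>graph_G\<close>
  (see \<open>pverts_graph_G\<close>).\<close>

definition new_vertex :: "nat pair_pre_digraph \<Rightarrow> nat" where
  "new_vertex G = Suc (card (pverts G))"

definition add_isolated :: "nat pair_pre_digraph \<Rightarrow> nat pair_pre_digraph" where
  "add_isolated G = \<lparr>pverts = insert (new_vertex G) (pverts G), parcs = parcs G\<rparr>"

definition add_dominating :: "nat pair_pre_digraph \<Rightarrow> nat pair_pre_digraph" where
  "add_dominating G = \<lparr>pverts = insert (new_vertex G) (pverts G),
     parcs = parcs G \<union> {new_vertex G} \<times> pverts G \<union> pverts G \<times> {new_vertex G}\<rparr>"

definition graph_G :: "nat \<Rightarrow> nat \<Rightarrow> nat pair_pre_digraph" where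
  "graph_G n r = (((add_dominating ^^ (r - 1)) \<circ> add_isolated) ^^ n) empty_graph"

definition graph_H :: "nat \<Rightarrow> nat \<Rightarrow> nat pair_pre_digraph" where
  "graph_H n r = \<lparr>pverts = {1..r * n},
     parcs = {(u, v). u \<noteq> v \<and> (\<exists>i\<in>{1..n}. u \<in> {i..i * r} \<and> v \<in> {i..i * r})}\<rparr>"

lemma pair_graph_add_isolated:
  assumes "pair_graph G" "pverts G = {1..m}"
  shows "pair_graph (add_isolated G) \<and> pverts (add_isolated G) = {1..Suc m}"
proof -
  interpret pair_graph G by fact
  have "pair_graph (add_isolated G)"
    using arc_fst_in_verts arc_snd_in_verts finite_arcs finite_verts no_loops sym_arcs assms(2)
    by unfold_locales
      (auto simp: add_isolated_def symmetric_def sym_def arcs_ends_def arc_to_ends_def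
        dest: in_arcsD1 in_arcsD2)
  then show ?thesis
    using assms(2) by (auto simp: add_isolated_def new_vertex_def)
qed

lemma pair_graph_add_dominating:
  assumes "pair_graph G" "pverts G = {1..m}"
  shows "pair_graph (add_dominating G) \<and> pverts (add_dominating G) = {1..Suc m}"
proof -
  interpret pair_graph G by fact
  have "pair_graph (add_dominating G)"
    using arc_fst_in_verts arc_snd_in_verts finite_arcs finite_verts no_loops sym_arcs assms(2)
    by unfold_locales
      (auto simp: add_dominating_def new_vertex_def symmetric_def sym_def arcs_ends_def
        arc_to_ends_def dest: in_arcsD1 in_arcsD2)
  then show ?thesis
    using assms(2) by (auto simp: add_dominating_def new_vertex_def)
qed

lemma pair_graph_graph_G_aux:
  assumes "r \<ge> 1"
  shows "pair_graph (graph_G n r) \<and> pverts (graph_G n r) = {1..r * n}"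
proof (induction n)
  case 0
  have "pair_graph empty_graph"
    by unfold_locales
      (auto simp: empty_graph_def symmetric_def sym_def arcs_ends_def)
  then show ?case by (simp add: graph_G_def) (simp add: empty_graph_def)
next
  case (Suc n)
  have step: "pair_graph ((add_dominating ^^ d) (add_isolated (graph_G n r))) \<and>
      pverts ((add_dominating ^^ d) (add_isolated (graph_G n r))) = {1..Suc (r * n) + d}" for d
  proof (induction d)
    case 0
    show ?case using pair_graph_add_isolated[of "graph_G n r" "r * n"] Suc.IH by simp
  next
    case (Suc d)
    then show ?case
      using pair_graph_add_dominating[of "(add_dominating ^^ d) (add_isolated (graph_G n r))"
          "Suc (r * n) + d"]
      by simp
  qed
  have "Suc (r * n) + (r - 1) = r * Suc n" using assms by simp
  then show ?case using step[of "r - 1"] by (simp only: graph_G_def funpow.simps o_apply)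
qed

lemma pverts_graph_G: "r \<ge> 1 \<Longrightarrow> pverts (graph_G n r) = {1..r * n}"
  using pair_graph_graph_G_aux by blast

lemma pair_graph_graph_G: "r \<ge> 1 \<Longrightarrow> pair_graph (graph_G n r)"
  using pair_graph_graph_G_aux by blast

lemma pair_graph_graph_H: "pair_graph (graph_H n r)"
proof -
  have sub: "parcs (graph_H n r) \<subseteq> {1..r * n} \<times> {1..r * n}"
  proof -
    have "i * r \<le> r * n" if "i \<le> n" for i using that by (simp add: mult.commute)
    then show ?thesis by (fastforce simp: graph_H_def intro: order_trans)
  qed
  then have "finite (parcs (graph_H n r))" by (rule finite_subset) simp
  with sub show ?thesis
    by unfold_locales
      (auto simp: graph_H_def symmetric_def sym_def arcs_ends_def arc_to_ends_def)
qed


section \<open>Increasing forests\<close>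

text \<open>\<open>fchild F u i\<close> is the child of \<open>u\<close> in slot \<open>i\<close>, if that slot is occupied.\<close>

record 'a forest =
  fverts :: "'a set"
  fchild :: "'a \<Rightarrow> nat \<Rightarrow> 'a option"

definition child_rel :: "'a forest \<Rightarrow> ('a \<times> 'a) set" where
  "child_rel F = {(u, v). \<exists>i. fchild F u i = Some v}"

definition components :: "'a forest \<Rightarrow> 'a set set" where
  "components F = fverts F //
     {(u, v). u \<in> fverts F \<and> v \<in> fverts F \<and> (u, v) \<in> (child_rel F \<union> (child_rel F)\<inverse>)\<^sup>*}"

text \<open>A rooted tree with edges directed away from the root.\<close>

definition rooted_tree :: "'a set \<Rightarrow> ('a \<times> 'a) set \<Rightarrow> 'a \<Rightarrow> bool" where
  "rooted_tree V R \<rho> \<longleftrightarrow> finite V \<and> R \<subseteq> V \<times> V \<and> \<rho> \<in> V \<and> (\<forall>v\<in>V. (\<rho>, v) \<in> R\<^sup>*) \<and>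
     (\<nexists>u. (u, \<rho>) \<in> R) \<and> (\<forall>v\<in>V - {\<rho>}. \<exists>!u. (u, v) \<in> R)"

definition component_root :: "'a forest \<Rightarrow> 'a set \<Rightarrow> 'a \<Rightarrow> bool" where
  "component_root F C \<rho> \<longleftrightarrow> rooted_tree C (child_rel F \<inter> C \<times> C) \<rho>"

definition rary_forest :: "nat \<Rightarrow> 'a forest \<Rightarrow> bool" where
  "rary_forest r F \<longleftrightarrow> finite (fverts F) \<and> child_rel F \<subseteq> fverts F \<times> fverts F \<and>
     (\<forall>C\<in>components F. \<exists>\<rho>. component_root F C \<rho>) \<and>
     (\<forall>u. dom (fchild F u) \<subseteq> {1..r} \<and> inj_on (fchild F u) (dom (fchild F u)))"

text \<open>The vertices are identified with their labels. As the labelling is a bijection onto \<open>{1..n}\<close>,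
  every isomorphism class of labelled forests has exactly one such representative.\<close>

definition increasing_forest :: "nat \<Rightarrow> nat \<Rightarrow> nat forest \<Rightarrow> bool" where
  "increasing_forest r n F \<longleftrightarrow> rary_forest r F \<and> fverts F = {1..n} \<and>
     (\<forall>p C. C \<in> components F \<and> p \<noteq> [] \<and> component_root F C (hd p) \<and>
        successively (\<lambda>u v. (u, v) \<in> child_rel F) p \<longrightarrow> sorted_wrt (<) p)"

definition increasing_forests :: "nat \<Rightarrow> nat \<Rightarrow> nat \<Rightarrow> nat forest set" where
  "increasing_forests r n k = {F. increasing_forest r n F \<and> card (components F) = k}"

end

theory Submission
  imports Defs
begin

text \<open>All three families of numbers are built up one vertex at a time, and they are compared through
  two operators on integer sequences: the shift \<open>S\<close>, \<open>(S a) j = a (j - 1)\<close>, and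
  \<open>(T\<^sub>d a) j = a (j - 1) + (j - d) a j\<close> (\<open>shift\<close> and \<open>extend_op d\<close> below).

  Let \<open>p = r - 1\<close>, and let \<open>\<delta>\<close> be the sequence of the empty object, \<open>unit_seq\<close>.
  A stable partition into \<open>j\<close> classes is extended to a new vertex by a new singleton class or by
  inserting the vertex in a class that avoids its neighbours. If the neighbours form a clique of size
  \<open>d\<close> then \<open>j - d\<close> classes avoid them, so the Stirling numbers change by \<open>T\<^sub>d\<close>; if the new
  vertex is dominating then no class is available, and they change by \<open>S\<close>
  (\<open>stirling_seq_add_simplicial\<close>, \<open>stirling_seq_add_dominating\<close>).

  \<^item> The sequence of \<open>G(n, r)\<close> is thus obtained by iterating \<open>S\<^sup>pT\<^sub>0\<close>, starting with \<open>\<delta>\<close>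
  (\<open>stirling_seq_graph_G_Suc\<close>).

  \<^item> A forest with \<open>n\<close> vertices and \<open>k\<close> components has \<open>n - k\<close> occupied slots, so the
  vertex \<open>n + 1\<close>, necessarily a leaf, can be hung in \<open>k + pn\<close> free slots or be a new root: the
  forest numbers change by \<open>T\<^sub>d\<close> with \<open>d = -pn\<close>. Since \<open>ST\<^sub>d\<close> is
  \<open>T\<^sub>e S\<close> with \<open>e = d + 1\<close>, the forest numbers shifted by \<open>pn\<close>
  are also obtained by iterating \<open>S\<^sup>pT\<^sub>0\<close> (\<open>forest_seq_Suc\<close>, \<open>shifted_forest_seq\<close>). To make the removal of the
  largest vertex a simple operation, increasing forests are first identified with their child
  functions (\<open>increasing_forests_eq\<close>).

  \<^item> In \<open>H(n, r)\<close> with its vertices added in increasing order, each vertex \<open>w + 1\<close> has a clique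
  of \<open>d(w) = w - \<lfloor>w / r\<rfloor>\<close> earlier neighbours. The list of these degrees consists of
  \<open>0, \<dots>, p\<close>, followed by the list for \<open>n - 1\<close> increased by \<open>p\<close>. The operators
  \<open>T\<^sub>d\<close> commute and \<open>T\<^sub>0\<delta> = S\<delta>\<close>, so the initial block turns \<open>\<delta>\<close> into
  \<open>T\<^sub>pS\<^sup>p\<delta>\<close>; pulling \<open>T\<^sub>p S\<^sup>p = S\<^sup>pT\<^sub>0\<close> to the outside gives the same recurrence
  a third time (\<open>stirling_seq_graph_H_Suc\<close>).\<close>

section \<open>Operators on sequences\<close>

definition shift :: "(nat \<Rightarrow> int) \<Rightarrow> nat \<Rightarrow> int" where
  "shift a j = (case j of 0 \<Rightarrow> 0 | Suc i \<Rightarrow> a i)"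

definition extend_op :: "int \<Rightarrow> (nat \<Rightarrow> int) \<Rightarrow> nat \<Rightarrow> int" where
  "extend_op d a j = shift a j + (int j - d) * a j"

definition unit_seq :: "nat \<Rightarrow> int" where
  "unit_seq j = (if j = 0 then 1 else 0)"

lemma shift_extend_op: "shift (extend_op d a) = extend_op (d + 1) (shift a)"
  by (rule ext) (auto simp: shift_def extend_op_def split: nat.split)

lemma shift_pow_extend_op:
  "(shift ^^ p) (extend_op d a) = extend_op (d + int p) ((shift ^^ p) a)"
  by (induction p) (simp_all add: shift_extend_op add_ac)

lemma shift_pow_apply: "(shift ^^ p) a (k + p) = a k"
  by (induction p) (simp_all add: shift_def)

lemma extend_op_commute: "extend_op d (extend_op e a) = extend_op e (extend_op d a)"
  by (rule ext) (auto simp: shift_def extend_op_def algebra_simps split: nat.split)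

lemma extend_op_unit_seq: "extend_op 0 unit_seq = shift unit_seq"
  by (rule ext) (auto simp: shift_def extend_op_def unit_seq_def split: nat.split)

lemma fold_extend_op_commute:
  "extend_op e (fold extend_op ds a) = fold extend_op ds (extend_op e a)"
  by (induction ds arbitrary: a) (simp_all add: extend_op_commute)

lemma shift_pow_fold_extend_op:
  "(shift ^^ p) (fold extend_op ds a) =
     fold extend_op (map (\<lambda>d. d + int p) ds) ((shift ^^ p) a)"
  by (induction ds arbitrary: a) (simp_all add: shift_pow_extend_op)

text \<open>These are the Stirling numbers of the complete graph on \<open>p\<close> vertices, whose only stable partition
  is the one into singletons. The induction replaces \<open>S\<^sup>p\<delta>\<close> under \<open>T\<^sub>p\<close> using \<open>T\<^sub>p S\<^sup>p = S\<^sup>p T\<^sub>0\<close>.\<close>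

lemma fold_extend_op_upt_unit_seq:
  "fold extend_op (map int [0..<p]) unit_seq = (shift ^^ p) unit_seq"
proof (induction p)
  case (Suc p)
  then show ?case
    using shift_pow_extend_op[of p 0 unit_seq]
    by (simp add: extend_op_unit_seq funpow_swap1)
qed simp

section \<open>Counting one-step extensions\<close>

definition count_by :: "'a set \<Rightarrow> ('a \<Rightarrow> nat) \<Rightarrow> nat \<Rightarrow> int" where
  "count_by X w j = int (card {x \<in> X. w x = j})"

text \<open>The common form of both counting arguments: an object of weight \<open>w x\<close> is extended either by a new
  part (option \<open>None\<close>), which raises the weight, or by putting the new point in one of the available
  \<open>slots\<close>, which preserves it. Parts are classes of a partition or components of a forest.\<close>

lemma count_extension:
  fixes slots :: "'a \<Rightarrow> 'b set"
  assumes bij: "bij_betw ext (SIGMA x:X. insert None (Some ` slots x)) Y"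
    and fin: "finite X" "\<And>x. x \<in> X \<Longrightarrow> finite (slots x)"
    and new: "\<And>x. x \<in> X \<Longrightarrow> w' (ext (x, None)) = Suc (w x)"
    and old: "\<And>x s. x \<in> X \<Longrightarrow> s \<in> slots x \<Longrightarrow> w' (ext (x, Some s)) = w x"
  shows "count_by Y w' j =
    shift (count_by X w) j + (\<Sum>x\<in>{x \<in> X. w x = j}. int (card (slots x)))"
proof -
  let ?D = "SIGMA x:X. insert None (Some ` slots x)"
  let ?A = "{x \<in> X. Suc (w x) = j} \<times> {None :: 'b option}"
  let ?B = "SIGMA x:{x \<in> X. w x = j}. Some ` slots x"
  have "bij_betw ext {z \<in> ?D. w' (ext z) = j} {y \<in> Y. w' y = j}"
    by (rule bij_betw_subset[OF bij]) (use bij_betw_imp_surj_on[OF bij, symmetric] in auto)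
  then have "card {y \<in> Y. w' y = j} = card {z \<in> ?D. w' (ext z) = j}"
    by (simp add: bij_betw_same_card)
  also have "{z \<in> ?D. w' (ext z) = j} = ?A \<union> ?B"
    using new old by auto
  also have "card (?A \<union> ?B) = card ?A + card ?B"
    by (rule card_Un_disjoint) (use fin in auto)
  also have "card ?B = (\<Sum>x\<in>{x \<in> X. w x = j}. card (Some ` slots x))"
    using fin by (intro card_SigmaI) auto
  also have "\<dots> = (\<Sum>x\<in>{x \<in> X. w x = j}. card (slots x))"
    by (simp add: card_image)
  finally show ?thesis
    by (cases j) (simp_all add: count_by_def shift_def card_cartesian_product)
qed

lemma count_extension_extend_op:
  assumes bij: "bij_betw ext (SIGMA x:X. insert None (Some ` slots x)) Y"
    and fin: "finite X" "\<And>x. x \<in> X \<Longrightarrow> finite (slots x)"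
    and new: "\<And>x. x \<in> X \<Longrightarrow> w' (ext (x, None)) = Suc (w x)"
    and old: "\<And>x s. x \<in> X \<Longrightarrow> s \<in> slots x \<Longrightarrow> w' (ext (x, Some s)) = w x"
    and slots: "\<And>x. x \<in> X \<Longrightarrow> int (card (slots x)) = int (w x) - d"
  shows "count_by Y w' = extend_op d (count_by X w)"
proof
  fix j
  have "(\<Sum>x\<in>{x \<in> X. w x = j}. int (card (slots x))) = (int j - d) * count_by X w j"
    using slots by (simp add: count_by_def)
  then show "count_by Y w' j = extend_op d (count_by X w) j"
    using count_extension[OF bij fin new old] by (simp add: extend_op_def)
qed

section \<open>Adding a vertex to a graph\<close>

definition stable_partitions :: "'a pair_pre_digraph \<Rightarrow> 'a set set set" where
  "stable_partitions G = {P. partition_on (pverts G) P \<and>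
     (\<forall>C\<in>P. \<forall>(u, v)\<in>parcs G. \<not> (u \<in> C \<and> v \<in> C))}"

definition stirling_seq :: "'a pair_pre_digraph \<Rightarrow> nat \<Rightarrow> int" where
  "stirling_seq G = count_by (stable_partitions G) card"

lemma stirling_seq_eq: "stirling_seq G j = int (graph_stirling G j)"
  unfolding stirling_seq_def count_by_def graph_stirling_def stable_partitions_def
  by (intro arg_cong[where f = "\<lambda>X. int (card X)"]) auto

definition add_vertex :: "'a \<Rightarrow> 'a set \<Rightarrow> 'a pair_pre_digraph \<Rightarrow> 'a pair_pre_digraph" where
  "add_vertex x N G = \<lparr>pverts = insert x (pverts G),
     parcs = parcs G \<union> {x} \<times> N \<union> N \<times> {x}\<rparr>"

definition adjoin :: "'a \<Rightarrow> 'a set set \<times> 'a set option \<Rightarrow> 'a set set" where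
  "adjoin x = (\<lambda>(P, s). case s of None \<Rightarrow> insert {x} P
     | Some C \<Rightarrow> insert (insert x C) (P - {C}))"

text \<open>Inverse of \<open>adjoin\<close>: deleting \<open>x\<close> may leave an empty class, which has to be dropped; the union
  merely extracts the unique class that contains \<open>x\<close>.\<close>

definition unjoin :: "'a \<Rightarrow> 'a set set \<Rightarrow> 'a set set \<times> 'a set option" where
  "unjoin x Q = ((\<lambda>D. D - {x}) ` Q - {{}},
     let C = \<Union>{D \<in> Q. x \<in> D} - {x} in if C = {} then None else Some C)"

lemma finite_stable_partitions: "finite (pverts G) \<Longrightarrow> finite (stable_partitions G)"
  unfolding stable_partitions_def
  by (rule finite_subset[OF _ finitely_many_partition_on[of "pverts G"]]) auto

lemma unjoin_adjoin:
  assumes P: "partition_on V P" and x: "x \<notin> V" and s: "s \<in> insert None (Some ` P)"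
  shows "unjoin x (adjoin x (P, s)) = (P, s)"
proof -
  have nx: "x \<notin> C" and ne: "C \<noteq> {}" if "C \<in> P" for C
    using that P x by (auto simp: partition_on_def)
  have id: "(\<lambda>D. D - {x}) ` P' = P'" if "P' \<subseteq> P" for P'
  proof -
    have "D - {x} = D" if "D \<in> P'" for D using that \<open>P' \<subseteq> P\<close> nx by blast
    then show ?thesis by simp
  qed
  show ?thesis
  proof (cases s)
    case None
    have "{D \<in> insert {x} P. x \<in> D} = {{x}}" using nx by auto
    then show ?thesis using None ne by (auto simp: unjoin_def adjoin_def id)
  next
    case (Some C)
    then have C: "C \<in> P" using s by auto
    have "{D \<in> insert (insert x C) (P - {C}). x \<in> D} = {insert x C}" using nx by auto
    then have "\<Union>{D \<in> adjoin x (P, s). x \<in> D} - {x} = C"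
      using nx[OF C] Some by (simp add: adjoin_def)
    moreover have "(\<lambda>D. D - {x}) ` adjoin x (P, s) = insert (insert x C - {x}) ((\<lambda>D. D - {x}) ` (P - {C}))"
      using Some by (simp add: adjoin_def)
    moreover have "insert (insert x C - {x}) ((\<lambda>D. D - {x}) ` (P - {C})) = P"
      using nx[OF C] C id[of "P - {C}"] by (simp add: insert_absorb)
    moreover have "{} \<notin> P" using ne by blast
    ultimately show ?thesis using Some ne[OF C] by (simp add: unjoin_def)
  qed
qed

lemma adjoin_unjoin:
  assumes Q: "partition_on (insert x V) Q" and x: "x \<notin> V"
  obtains P s where "partition_on V P" "s \<in> insert None (Some ` P)" "unjoin x Q = (P, s)"
    "adjoin x (P, s) = Q"
proof -
  obtain D where D: "D \<in> Q" "x \<in> D" using Q by (auto simp: partition_on_def)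
  have uniq: "E = D" if "E \<in> Q" "x \<in> E" for E
    using that D Q by (auto simp: partition_on_def disjoint_def)
  have dj: "E \<inter> D = {}" if "E \<in> Q" "E \<noteq> D" for E
    using that D Q by (auto simp: partition_on_def disjoint_def)
  have ne: "{} \<notin> Q" using Q by (auto simp: partition_on_def)
  have "{E \<in> Q. x \<in> E} = {D}" using D uniq by blast
  then have D': "\<Union>{E \<in> Q. x \<in> E} = D" by simp
  have id: "(\<lambda>E. E - {x}) ` (Q - {D}) = Q - {D}"
  proof -
    have "E - {x} = E" if "E \<in> Q - {D}" for E using that uniq by blast
    then show ?thesis by simp
  qed
  have Q': "Q = insert D (Q - {D})" using D by auto
  have im: "(\<lambda>E. E - {x}) ` Q = insert (D - {x}) (Q - {D})"
    by (subst Q') (simp only: image_insert id)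
  have nD: "D - {x} \<notin> Q - {D}" if "D - {x} \<noteq> {}"
    using that dj[of "D - {x}"] by auto
  let ?P = "insert (D - {x}) (Q - {D}) - {{}}"
  let ?s = "if D - {x} = {} then None else Some (D - {x})"
  have "partition_on (insert x V - {x}) ((\<lambda>E. E - {x}) ` Q - {{}})"
    by (rule partition_on_transform[OF Q]) (auto simp: disjnt_def)
  then have "partition_on V ?P" using x by (simp add: im)
  moreover have "?s \<in> insert None (Some ` ?P)" by auto
  moreover have "unjoin x Q = (?P, ?s)" by (simp add: unjoin_def D' im Let_def)
  moreover have "adjoin x (?P, ?s) = Q"
  proof (cases "D - {x} = {}")
    case True
    then have "D = {x}" using D by auto
    then show ?thesis using D ne by (auto simp: adjoin_def)
  next
    case False
    have "insert x (D - {x}) = D" using D by auto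
    then show ?thesis using False nD ne Q' by (auto simp: adjoin_def)
  qed
  ultimately show thesis by (rule that)
qed


lemma bij_betw_adjoin:
  assumes x: "x \<notin> pverts G" and N: "N \<subseteq> pverts G" and arcs: "parcs G \<subseteq> pverts G \<times> pverts G"
  shows "bij_betw (adjoin x)
    (SIGMA P:stable_partitions G. insert None (Some ` {C \<in> P. C \<inter> N = {}}))
    (stable_partitions (add_vertex x N G))"
proof (rule bij_betw_byWitness[where f' = "unjoin x"])
  let ?V = "pverts G"
  let ?D = "SIGMA P:stable_partitions G. insert None (Some ` {C \<in> P. C \<inter> N = {}})"
  have part: "partition_on ?V P" if "P \<in> stable_partitions G" for P
    using that by (simp add: stable_partitions_def)
  show "\<forall>z\<in>?D. unjoin x (adjoin x z) = z"
    using unjoin_adjoin[OF part x] by blast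
  have N': "x \<notin> N" using x N by auto
  show "adjoin x ` ?D \<subseteq> stable_partitions (add_vertex x N G)"
  proof clarify
    fix P s
    assume P: "P \<in> stable_partitions G" and s: "s \<in> insert None (Some ` {C \<in> P. C \<inter> N = {}})"
    have U: "\<Union>P = ?V" and dj: "disjoint P" and ne: "{} \<notin> P"
      using part[OF P] by (auto simp: partition_on_def)
    have st: "\<not> (u \<in> C \<and> v \<in> C)" if "C \<in> P" "(u, v) \<in> parcs G" for C u v
      using P that by (auto simp: stable_partitions_def)
    have nx: "x \<notin> C" if "C \<in> P" for C using that U x by auto
    show "adjoin x (P, s) \<in> stable_partitions (add_vertex x N G)"
    proof (cases s)
      case None
      have "partition_on (insert x ?V) (insert {x} P)"
        using U dj ne x by (auto simp: partition_on_def disjoint_def)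
      then show ?thesis
        using None st nx x N' arcs
        by (auto simp: stable_partitions_def add_vertex_def adjoin_def)
    next
      case (Some C)
      then have C: "C \<in> P" "C \<inter> N = {}" using s by auto
      have dC: "E \<inter> C = {}" if "E \<in> P - {C}" for E
        using that C(1) dj by (auto simp: disjoint_def)
      have "\<Union>(insert (insert x C) (P - {C})) = insert x ?V" using U C(1) by auto
      moreover have "disjoint (insert (insert x C) (P - {C}))"
        using dj dC nx by (auto simp: disjoint_def)
      ultimately have "partition_on (insert x ?V) (insert (insert x C) (P - {C}))"
        using ne by (auto simp: partition_on_def)
      then show ?thesis
        using Some st nx x N' arcs C
        by (fastforce simp: stable_partitions_def add_vertex_def adjoin_def)
    qed
  qed
  have main: "unjoin x Q \<in> ?D \<and> adjoin x (unjoin x Q) = Q"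
    if "Q \<in> stable_partitions (add_vertex x N G)" for Q
  proof -
    have Q: "partition_on (insert x ?V) Q"
      and st: "\<And>C u v. C \<in> Q \<Longrightarrow> (u, v) \<in> parcs G \<union> {x} \<times> N \<union> N \<times> {x} \<Longrightarrow> \<not> (u \<in> C \<and> v \<in> C)"
      using that by (auto simp: stable_partitions_def add_vertex_def)
    obtain P s where P: "partition_on ?V P" "s \<in> insert None (Some ` P)" "unjoin x Q = (P, s)"
      "adjoin x (P, s) = Q"
      using adjoin_unjoin[OF Q x] by blast
    have sub: "\<exists>D\<in>Q. C \<subseteq> D" if "C \<in> P" for C
      using that P(4) by (cases s) (auto simp: adjoin_def)
    have "P \<in> stable_partitions G"
      unfolding stable_partitions_def using P(1) sub st by fastforce
    moreover have "C \<inter> N = {}" if "s = Some C" for C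
    proof -
      have "insert x C \<in> Q" using that P(4) by (auto simp: adjoin_def)
      then show ?thesis using st by blast
    qed
    ultimately show ?thesis using P by auto
  qed
  then show "\<forall>Q\<in>stable_partitions (add_vertex x N G). adjoin x (unjoin x Q) = Q"
    and "unjoin x ` stable_partitions (add_vertex x N G) \<subseteq> ?D" by blast+
qed

lemma card_adjoin:
  assumes "partition_on V P" "finite V" "x \<notin> V"
  shows "card (adjoin x (P, None)) = Suc (card P)"
    and "C \<in> P \<Longrightarrow> card (adjoin x (P, Some C)) = card P"
proof -
  have fin: "finite P" using assms finite_elements by blast
  have nx: "x \<notin> D" if "D \<in> P" for D using that assms by (auto simp: partition_on_def)
  have "{x} \<notin> P" using nx by blast
  then show "card (adjoin x (P, None)) = Suc (card P)" using fin by (simp add: adjoin_def)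
  assume C: "C \<in> P"
  have "insert x C \<notin> P" using nx by blast
  moreover have "card P > 0" using C fin by (auto simp: card_gt_0_iff)
  ultimately show "card (adjoin x (P, Some C)) = card P"
    using fin C by (simp add: adjoin_def)
qed

lemma stirling_seq_add_dominating:
  assumes "finite (pverts G)" "x \<notin> pverts G" "parcs G \<subseteq> pverts G \<times> pverts G"
  shows "stirling_seq (add_vertex x (pverts G) G) = shift (stirling_seq G)"
proof
  fix j
  have part: "partition_on (pverts G) P" if "P \<in> stable_partitions G" for P
    using that by (simp add: stable_partitions_def)
  have none: "{C \<in> P. C \<inter> pverts G = {}} = {}" if "P \<in> stable_partitions G" for P
  proof -
    have "\<Union>P = pverts G" "{} \<notin> P" using part[OF that] by (simp_all add: partition_on_def)
    moreover from this have "C \<inter> pverts G = C" if "C \<in> P" for C using that by blast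
    ultimately show ?thesis by (metis (mono_tags, lifting) empty_Collect_eq)
  qed
  have "stirling_seq (add_vertex x (pverts G) G) j = shift (stirling_seq G) j +
      (\<Sum>P\<in>{P \<in> stable_partitions G. card P = j}. int (card {C \<in> P. C \<inter> pverts G = {}}))"
    unfolding stirling_seq_def
  proof (rule count_extension[OF bij_betw_adjoin[OF assms(2) order_refl assms(3)]
        finite_stable_partitions[OF assms(1)]])
    fix P assume P: "P \<in> stable_partitions G"
    show "finite {C \<in> P. C \<inter> pverts G = {}}" by (simp only: none[OF P] finite.emptyI)
    show "card (adjoin x (P, None)) = Suc (card P)" by (rule card_adjoin[OF part[OF P] assms(1,2)])
    show "card (adjoin x (P, Some C)) = card P" if "C \<in> {C \<in> P. C \<inter> pverts G = {}}" for C
      using none[OF P] that by blast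
  qed
  then show "stirling_seq (add_vertex x (pverts G) G) j = shift (stirling_seq G) j"
    using none by simp
qed

text \<open>Vertices of a clique lie in distinct classes, so exactly \<open>card N\<close> classes meet \<open>N\<close>.\<close>

lemma stirling_seq_add_simplicial:
  assumes fin: "finite (pverts G)" and x: "x \<notin> pverts G"
    and arcs: "parcs G \<subseteq> pverts G \<times> pverts G"
    and N: "N \<subseteq> pverts G"
    and clique: "\<And>u v. u \<in> N \<Longrightarrow> v \<in> N \<Longrightarrow> u \<noteq> v \<Longrightarrow> (u, v) \<in> parcs G"
  shows "stirling_seq (add_vertex x N G) = extend_op (int (card N)) (stirling_seq G)"
  unfolding stirling_seq_def
proof (rule count_extension_extend_op[OF bij_betw_adjoin[OF x N arcs] finite_stable_partitions[OF fin]])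
  fix P assume P: "P \<in> stable_partitions G"
  have part: "partition_on (pverts G) P" using P by (simp add: stable_partitions_def)
  have finP: "finite P" using part fin finite_elements by blast
  show "finite {C \<in> P. C \<inter> N = {}}" using finP by simp
  show "card (adjoin x (P, None)) = Suc (card P)" by (rule card_adjoin[OF part fin x])
  show "card (adjoin x (P, Some C)) = card P" if "C \<in> {C \<in> P. C \<inter> N = {}}" for C
    using card_adjoin[OF part fin x] that by blast
  \<comment> \<open>The map sending a vertex of \<open>N\<close> to its class is a bijection onto the classes that meet \<open>N\<close>.\<close>
  have "\<exists>C\<in>P. u \<in> C" if "u \<in> N" for u
    using that N part by (auto simp: partition_on_def)
  then obtain cl where cl: "\<And>u. u \<in> N \<Longrightarrow> cl u \<in> P \<and> u \<in> cl u" by metis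
  have "inj_on cl N"
  proof (rule inj_onI, rule ccontr)
    fix u v assume uv: "u \<in> N" "v \<in> N" "cl u = cl v" "u \<noteq> v"
    then show False using cl[of u] cl[of v] clique[of u v] P
      by (auto simp: stable_partitions_def)
  qed
  moreover have "cl ` N = {C \<in> P. C \<inter> N \<noteq> {}}"
  proof (intro equalityI subsetI)
    fix C assume "C \<in> {C \<in> P. C \<inter> N \<noteq> {}}"
    then obtain u where u: "C \<in> P" "u \<in> C" "u \<in> N" by auto
    then have "cl u = C" using cl[of u] part by (auto simp: partition_on_def disjoint_def)
    then show "C \<in> cl ` N" using u by auto
  qed (use cl in auto)
  ultimately have "card {C \<in> P. C \<inter> N \<noteq> {}} = card N" by (metis card_image)
  moreover have "card P = card {C \<in> P. C \<inter> N = {}} + card {C \<in> P. C \<inter> N \<noteq> {}}"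
    using finP by (subst card_Un_disjoint[symmetric]) (auto intro: arg_cong[where f = card])
  ultimately show "int (card {C \<in> P. C \<inter> N = {}}) = int (card P) - int (card N)" by simp
qed

section \<open>The Stirling numbers of the two graphs\<close>

lemma stirling_seq_empty: "pverts G = {} \<Longrightarrow> stirling_seq G = unit_seq"
proof
  fix j assume "pverts G = {}"
  then have "P \<in> stable_partitions G \<longleftrightarrow> P = {}" for P
    by (auto simp: stable_partitions_def partition_on_empty)
  then show "stirling_seq G j = unit_seq j"
    by (simp add: stirling_seq_def count_by_def unit_seq_def Collect_conv_if)
qed

lemma stirling_seq_graph_G_Suc:
  assumes "r \<ge> 1"
  shows "stirling_seq (graph_G (Suc n) r) =
    (shift ^^ (r - 1)) (extend_op 0 (stirling_seq (graph_G n r)))"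
proof -
  define G where "G = graph_G n r"
  have pg: "pair_graph G" and V: "pverts G = {1..r * n}"
    using pair_graph_graph_G[OF assms] pverts_graph_G[OF assms] by (auto simp: G_def)
  have arcs: "parcs H \<subseteq> pverts H \<times> pverts H" if "pair_graph H" for H :: "nat pair_pre_digraph"
  proof -
    interpret pair_graph H by fact
    show ?thesis using in_arcsD1 in_arcsD2 by auto
  qed
  have *: "pair_graph ((add_dominating ^^ d) (add_isolated G)) \<and>
      pverts ((add_dominating ^^ d) (add_isolated G)) = {1..Suc (r * n) + d} \<and>
      stirling_seq ((add_dominating ^^ d) (add_isolated G)) =
        (shift ^^ d) (extend_op 0 (stirling_seq G))" for d
  proof (induction d)
    case 0
    have "add_isolated G = add_vertex (new_vertex G) {} G"
      by (simp add: add_isolated_def add_vertex_def)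
    then show ?case
      using pair_graph_add_isolated[OF pg V] stirling_seq_add_simplicial[of G "new_vertex G" "{}"]
        arcs[OF pg] V by (simp add: new_vertex_def)
  next
    case (Suc d)
    let ?H = "(add_dominating ^^ d) (add_isolated G)"
    have "add_dominating ?H = add_vertex (new_vertex ?H) (pverts ?H) ?H"
      by (simp add: add_dominating_def add_vertex_def)
    then show ?case
      using pair_graph_add_dominating[of ?H "Suc (r * n) + d"]
        stirling_seq_add_dominating[of ?H "new_vertex ?H"] arcs[of ?H] Suc.IH
      by (simp add: new_vertex_def)
  qed
  have "graph_G (Suc n) r = (add_dominating ^^ (r - 1)) (add_isolated G)"
    by (simp add: graph_G_def G_def)
  then show ?thesis using * by (simp add: G_def)
qed

text \<open>For \<open>u < v\<close>, some segment \<open>{i..i * r}\<close> contains both iff the one with \<open>i = u\<close> does. This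
  description of adjacency does not mention \<open>n\<close>, so it also describes the graph induced on
  an arbitrary initial segment of the vertices.\<close>

definition graph_H_prefix :: "nat \<Rightarrow> nat \<Rightarrow> nat pair_pre_digraph" where
  "graph_H_prefix r w = \<lparr>pverts = {1..w},
     parcs = {(u, v). u \<in> {1..w} \<and> v \<in> {1..w} \<and> u \<noteq> v \<and> u \<le> r * v \<and> v \<le> r * u}\<rparr>"

lemma graph_H_eq_prefix:
  assumes "r \<ge> 1"
  shows "graph_H n r = graph_H_prefix r (r * n)"
proof -
  have le: "m \<le> r * m" for m using assms by simp
  have "(\<exists>i\<in>{1..n}. u \<in> {i..i * r} \<and> v \<in> {i..i * r}) \<longleftrightarrow>
      u \<in> {1..r * n} \<and> v \<in> {1..r * n} \<and> u \<le> r * v \<and> v \<le> r * u" (is "?L \<longleftrightarrow> ?R") for u v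
  proof
    assume ?L
    then obtain i where i: "1 \<le> i" "i \<le> n" "i \<le> u" "u \<le> r * i" "i \<le> v" "v \<le> r * i"
      by (auto simp: mult.commute)
    have "r * i \<le> r * n" "r * i \<le> r * u" "r * i \<le> r * v" using i by auto
    then have "u \<le> r * n" "v \<le> r * n" "u \<le> r * v" "v \<le> r * u"
      using i(4,6) by (blast intro: order_trans)+
    then show ?R using i by simp
  next
    assume R: ?R
    \<comment> \<open>The smaller endpoint is the natural choice; the cap by \<open>n\<close> covers the case that both
      endpoints exceed \<open>n\<close>, where the last segment \<open>{n..n * r}\<close> contains them.\<close>
    let ?i = "min (min u v) n"
    have n: "n \<ge> 1" using R by (cases n) auto
    have "u \<le> r * ?i \<and> v \<le> r * ?i" using R le by (auto simp: min_def)
    then show ?L using R n by (intro bexI[of _ ?i]) (auto simp: mult.commute)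
  qed
  then show ?thesis by (auto simp: graph_H_def graph_H_prefix_def)
qed

text \<open>The order \<open>1, 2, 3, \<dots>\<close> is a perfect elimination order: the earlier neighbours of \<open>w + 1\<close> are
  \<open>w div r + 1, \<dots>, w\<close>, and all of them are adjacent to each other because two numbers
  whose larger one is at most \<open>w\<close> are adjacent if \<open>w + 1\<close> is at most \<open>r\<close> times the smaller one.\<close>

lemma stirling_seq_graph_H_prefix:
  assumes "r \<ge> 1"
  shows "stirling_seq (graph_H_prefix r w) =
    fold extend_op (map (\<lambda>i. int (i - i div r)) [0..<w]) unit_seq"
proof (induction w)
  case 0
  show ?case by (simp add: stirling_seq_empty graph_H_prefix_def)
next
  case (Suc w)
  let ?N = "{Suc (w div r)..w}"
  have "w < r * u \<longleftrightarrow> w div r < u" for u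
    using assms by (simp add: div_less_iff_less_mult mult.commute)
  then have nb: "Suc w \<le> r * u \<longleftrightarrow> Suc (w div r) \<le> u" for u by (simp add: Suc_le_eq)
  have le: "u \<le> r * v" if "u \<le> v" for u v
    using assms that by (metis le_trans mult_le_mono1 mult_1)
  have "graph_H_prefix r (Suc w) = add_vertex (Suc w) ?N (graph_H_prefix r w)"
  proof -
    have "parcs (graph_H_prefix r (Suc w)) = parcs (graph_H_prefix r w) \<union> {Suc w} \<times> ?N \<union> ?N \<times> {Suc w}"
    proof (intro set_eqI)
      fix e :: "nat \<times> nat"
      obtain u v where e: "e = (u, v)" by (cases e)
      consider "u = Suc w" | "v = Suc w" "u \<noteq> Suc w" | "u \<noteq> Suc w" "v \<noteq> Suc w" by blast
      then show "e \<in> parcs (graph_H_prefix r (Suc w)) \<longleftrightarrow>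
          e \<in> parcs (graph_H_prefix r w) \<union> {Suc w} \<times> ?N \<union> ?N \<times> {Suc w}"
      proof cases
        case 1
        then show ?thesis using nb[of v] le[of v "Suc w"]
          by (auto simp: e graph_H_prefix_def simp del: mult_Suc_right)
      next
        case 2
        then show ?thesis using nb[of u] le[of u "Suc w"]
          by (auto simp: e graph_H_prefix_def simp del: mult_Suc_right)
      next
        case 3
        then show ?thesis by (auto simp: e graph_H_prefix_def)
      qed
    qed
    moreover have "pverts (graph_H_prefix r (Suc w)) = insert (Suc w) (pverts (graph_H_prefix r w))"
      by (auto simp: graph_H_prefix_def)
    ultimately show ?thesis by (intro pair_pre_digraph.equality) (simp_all add: add_vertex_def)
  qed
  moreover have "stirling_seq (add_vertex (Suc w) ?N (graph_H_prefix r w)) =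
      extend_op (int (card ?N)) (stirling_seq (graph_H_prefix r w))"
  proof (rule stirling_seq_add_simplicial)
    fix u v assume uv: "u \<in> ?N" "v \<in> ?N" "u \<noteq> v"
    then have "Suc w \<le> r * u" "Suc w \<le> r * v" using nb by auto
    with uv show "(u, v) \<in> parcs (graph_H_prefix r w)" by (auto simp: graph_H_prefix_def)
  qed (auto simp: graph_H_prefix_def)
  ultimately show ?case using Suc.IH by simp
qed

text \<open>The last block of vertices of \<open>H(n + 1, r)\<close> contributes other operators than that of
  \<open>G(n + 1, r)\<close>. The recurrence appears if the \<^emph>\<open>first\<close> block is split off instead, since increasing a
  vertex by \<open>r\<close> increases its number of earlier neighbours by \<open>r - 1\<close>.\<close>

lemma stirling_seq_graph_H_Suc:
  assumes r: "r \<ge> 1"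
  shows "stirling_seq (graph_H (Suc n) r) =
    (shift ^^ (r - 1)) (extend_op 0 (stirling_seq (graph_H n r)))"
proof -
  define p where "p = r - 1"
  define d where "d = (\<lambda>i. int (i - i div r))"
  let ?ds = "map d [0..<r * n]"
  have r: "r = Suc p" using r by (simp add: p_def)
  have seq: "stirling_seq (graph_H m r) = fold extend_op (map d [0..<r * m]) unit_seq" for m
    using stirling_seq_graph_H_prefix[of r "r * m"] graph_H_eq_prefix[of r m] assms
    by (simp add: d_def)
  have first: "map d [0..<r] = map int [0..<r]" by (auto simp: d_def)
  have step: "d (i + r) = d i + int p" for i
  proof -
    have "(i + r) div r = Suc (i div r)" using assms by simp
    moreover have "i div r \<le> i" by simp
    ultimately show ?thesis using r by (simp add: d_def)
  qed
  have "[0..<r * Suc n] = [0..<r] @ map (\<lambda>i. i + r) [0..<r * n]"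
    using upt_add_eq_append[of 0 r "r * n"] map_add_upt[of r "r * n"] by (simp add: add_ac)
  then have "map d [0..<r * Suc n] = map int [0..<r] @ map (\<lambda>e. e + int p) ?ds"
    using first by (simp add: step)
  then have "stirling_seq (graph_H (Suc n) r) =
      fold extend_op (map (\<lambda>e. e + int p) ?ds) (fold extend_op (map int [0..<r]) unit_seq)"
    by (simp add: seq)
  also have "fold extend_op (map int [0..<r]) unit_seq = extend_op (int p) ((shift ^^ p) unit_seq)"
    using fold_extend_op_upt_unit_seq[of p] by (simp add: r)
  also have "fold extend_op (map (\<lambda>e. e + int p) ?ds) \<dots> =
      extend_op (int p) ((shift ^^ p) (fold extend_op ?ds unit_seq))"
    by (simp add: fold_extend_op_commute shift_pow_fold_extend_op)
  also have "\<dots> = (shift ^^ p) (extend_op 0 (stirling_seq (graph_H n r)))"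
    by (simp add: shift_pow_extend_op seq)
  finally show ?thesis by (simp add: p_def)
qed



section \<open>Increasing forests as slot maps\<close>

text \<open>A forest on \<open>{1..n}\<close> is determined by its child function. That a child function comes from an
  increasing forest is a local condition: labels increase along edges, and every vertex
  has at most one parent slot. Acyclicity then is automatic.\<close>

definition slot_maps :: "nat \<Rightarrow> nat \<Rightarrow> (nat \<Rightarrow> nat \<Rightarrow> nat option) set" where
  "slot_maps r n = {c.
     (\<forall>u i v. c u i = Some v \<longrightarrow> 1 \<le> u \<and> u < v \<and> v \<le> n \<and> 1 \<le> i \<and> i \<le> r) \<and>
     (\<forall>u i u' i' v. c u i = Some v \<longrightarrow> c u' i' = Some v \<longrightarrow> u = u' \<and> i = i')}"

lemma slot_mapsD:
  assumes "c \<in> slot_maps r n" "c u i = Some v"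
  shows "1 \<le> u" "u < v" "v \<le> n" "1 \<le> i" "i \<le> r"
  using assms by (auto simp: slot_maps_def)

lemma slot_maps_inj:
  "c \<in> slot_maps r n \<Longrightarrow> c u i = Some v \<Longrightarrow> c u' i' = Some v \<Longrightarrow> u = u' \<and> i = i'"
  unfolding slot_maps_def by blast

definition roots :: "nat \<Rightarrow> (nat \<Rightarrow> nat \<Rightarrow> nat option) \<Rightarrow> nat set" where
  "roots n c = {v \<in> {1..n}. \<forall>u i. c u i \<noteq> Some v}"

definition free_slots :: "nat \<Rightarrow> nat \<Rightarrow> (nat \<Rightarrow> nat \<Rightarrow> nat option) \<Rightarrow> (nat \<times> nat) set" where
  "free_slots r n c = {(u, i). u \<in> {1..n} \<and> i \<in> {1..r} \<and> c u i = None}"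

lemma finite_free_slots: "finite (free_slots r n c)"
  by (rule finite_subset[of _ "{1..n} \<times> {1..r}"]) (auto simp: free_slots_def)

text \<open>Every vertex that is not a root occupies exactly one of the \<open>r * n\<close> slots.\<close>

lemma card_free_slots:
  assumes c: "c \<in> slot_maps r n"
  shows "int (card (free_slots r n c)) = int (card (roots n c)) + (int r - 1) * int n"
proof -
  let ?used = "{(u, i). c u i \<noteq> None}"
  have "bij_betw (\<lambda>(u, i). the (c u i)) ?used ({1..n} - roots n c)"
    unfolding bij_betw_def
  proof
    show "inj_on (\<lambda>(u, i). the (c u i)) ?used"
      using slot_maps_inj[OF c] by (fastforce intro!: inj_onI)
    show "(\<lambda>(u, i). the (c u i)) ` ?used = {1..n} - roots n c"
    proof (intro equalityI subsetI)
      fix v assume "v \<in> {1..n} - roots n c"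
      then obtain u i where "c u i = Some v" by (auto simp: roots_def)
      then show "v \<in> (\<lambda>(u, i). the (c u i)) ` ?used" by (intro image_eqI[of _ _ "(u, i)"]) auto
    qed (use slot_mapsD[OF c] in \<open>fastforce simp: roots_def\<close>)
  qed
  then have "card ?used = card ({1..n} - roots n c)" by (rule bij_betw_same_card)
  also have "\<dots> = n - card (roots n c)"
    by (subst card_Diff_subset) (auto simp: roots_def)
  finally have used: "card ?used = n - card (roots n c)" .
  have le: "card (roots n c) \<le> n"
    using card_mono[of "{1..n}" "roots n c"] by (simp add: roots_def subset_iff)
  have sub: "?used \<subseteq> {1..n} \<times> {1..r}"
  proof clarify
    fix u i v assume "c u i = Some v"
    from slot_mapsD[OF c this] show "u \<in> {1..n} \<and> i \<in> {1..r}" by simp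
  qed
  have "free_slots r n c = {1..n} \<times> {1..r} - ?used" by (auto simp: free_slots_def)
  then have "card (free_slots r n c) = n * r - card ?used"
    using card_Diff_subset[OF finite_subset[OF sub] sub] by simp
  moreover have "card ?used \<le> n * r" using card_mono[OF _ sub] by simp
  ultimately show ?thesis using used le by (simp add: of_nat_diff algebra_simps)
qed

definition attach :: "nat \<Rightarrow> (nat \<Rightarrow> nat \<Rightarrow> nat option) \<times> (nat \<times> nat) option \<Rightarrow>
    nat \<Rightarrow> nat \<Rightarrow> nat option" where
  "attach v = (\<lambda>(c, s) u i. if s = Some (u, i) then Some v else c u i)"

text \<open>Inverse of \<open>attach\<close>; the slot of \<open>v\<close> is chosen by \<open>SOME\<close>, and it is unique in a slot map.\<close>

definition detach :: "nat \<Rightarrow> (nat \<Rightarrow> nat \<Rightarrow> nat option) \<Rightarrow>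
    (nat \<Rightarrow> nat \<Rightarrow> nat option) \<times> (nat \<times> nat) option" where
  "detach v c = ((\<lambda>u i. if c u i = Some v then None else c u i),
     if \<exists>u i. c u i = Some v then Some (SOME (u, i). c u i = Some v) else None)"

text \<open>The largest label is a leaf, so it can be removed; conversely it may be added in any free slot or as
  a new root.\<close>

lemma bij_betw_attach:
  "bij_betw (attach (Suc n)) (SIGMA c:slot_maps r n. insert None (Some ` free_slots r n c))
     (slot_maps r (Suc n))"
proof (rule bij_betw_byWitness[where f' = "detach (Suc n)"])
  let ?D = "SIGMA c:slot_maps r n. insert None (Some ` free_slots r n c)"
  show "\<forall>z\<in>?D. detach (Suc n) (attach (Suc n) z) = z"
  proof clarify
    fix c s assume c: "c \<in> slot_maps r n" and s: "s \<in> insert None (Some ` free_slots r n c)"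
    have no: "c u i \<noteq> Some (Suc n)" for u i using slot_mapsD(3)[OF c, of u i "Suc n"] by auto
    show "detach (Suc n) (attach (Suc n) (c, s)) = (c, s)"
      using s no by (auto simp: detach_def attach_def free_slots_def fun_eq_iff)
  qed
  show "attach (Suc n) ` ?D \<subseteq> slot_maps r (Suc n)"
  proof clarify
    fix c s assume c: "c \<in> slot_maps r n" and s: "s \<in> insert None (Some ` free_slots r n c)"
    have no: "c u i \<noteq> Some (Suc n)" for u i using slot_mapsD(3)[OF c, of u i "Suc n"] by auto
    show "attach (Suc n) (c, s) \<in> slot_maps r (Suc n)"
      unfolding slot_maps_def
    proof (intro CollectI conjI allI impI)
      fix u i v assume "attach (Suc n) (c, s) u i = Some v"
      then show "1 \<le> u" "u < v" "v \<le> Suc n" "1 \<le> i" "i \<le> r"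
        using s slot_mapsD[OF c, of u i v]
        by (auto simp: attach_def free_slots_def split: if_splits)
    next
      fix u i u' i' v
      assume "attach (Suc n) (c, s) u i = Some v" "attach (Suc n) (c, s) u' i' = Some v"
      then show "u = u'" "i = i'"
        using no slot_maps_inj[OF c, of u i v u' i'] by (auto simp: attach_def split: if_splits)
    qed
  qed
  have main: "detach (Suc n) c \<in> ?D \<and> attach (Suc n) (detach (Suc n) c) = c"
    if c: "c \<in> slot_maps r (Suc n)" for c
  proof -
    let ?c = "\<lambda>u i. if c u i = Some (Suc n) then None else c u i"
    have c': "?c \<in> slot_maps r n"
      unfolding slot_maps_def
    proof (intro CollectI conjI allI impI)
      fix u i v assume "?c u i = Some v"
      then show "1 \<le> u" "u < v" "v \<le> n" "1 \<le> i" "i \<le> r"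
        using slot_mapsD[OF c, of u i v] by (auto simp: le_Suc_eq split: if_splits)
    next
      fix u i u' i' v assume "?c u i = Some v" "?c u' i' = Some v"
      then show "u = u'" "i = i'"
        using slot_maps_inj[OF c, of u i v u' i'] by (auto split: if_splits)
    qed
    show ?thesis
    proof (cases "\<exists>u i. c u i = Some (Suc n)")
      case False
      then have "detach (Suc n) c = (c, None)" by (auto simp: detach_def fun_eq_iff)
      moreover have "?c = c" using False by (auto simp: fun_eq_iff)
      ultimately show ?thesis using c' by (simp add: attach_def)
    next
      case True
      then obtain u i where ui: "c u i = Some (Suc n)" by blast
      have uniq: "c u' i' = Some (Suc n) \<longleftrightarrow> u' = u \<and> i' = i" for u' i'
        using ui slot_maps_inj[OF c ui] by metis
      then have eq: "detach (Suc n) c = (?c, Some (u, i))"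
        using ui by (auto simp: detach_def)
      have "(u, i) \<in> free_slots r n ?c"
        using ui slot_mapsD[OF c ui] by (auto simp: free_slots_def)
      then have "(?c, Some (u, i)) \<in> ?D" using c' by blast
      moreover have "attach (Suc n) (?c, Some (u, i)) = c"
      proof (intro ext)
        fix a b show "attach (Suc n) (?c, Some (u, i)) a b = c a b"
          using ui uniq[of a b] by (cases "a = u \<and> b = i") (auto simp: attach_def)
      qed
      ultimately show ?thesis unfolding eq by blast
    qed
  qed
  then show "\<forall>c\<in>slot_maps r (Suc n). attach (Suc n) (detach (Suc n) c) = c"
    and "detach (Suc n) ` slot_maps r (Suc n) \<subseteq> ?D" by blast+
qed

lemma slot_maps_0: "slot_maps r 0 = {\<lambda>_ _. None}"
proof -
  have "c = (\<lambda>_ _. None)" if "c \<in> slot_maps r 0" for c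
  proof (intro ext)
    fix u i show "c u i = None" using slot_mapsD[OF that, of u i] by (cases "c u i") auto
  qed
  then show ?thesis by (auto simp: slot_maps_def)
qed

lemma finite_slot_maps: "finite (slot_maps r n)"
proof (induction n)
  case (Suc n)
  have "finite (SIGMA c:slot_maps r n. insert None (Some ` free_slots r n c))"
    using Suc.IH finite_free_slots by blast
  then show ?case using bij_betw_finite[OF bij_betw_attach] by blast
qed (simp add: slot_maps_0)

lemma card_roots_attach:
  assumes c: "c \<in> slot_maps r n"
  shows "card (roots (Suc n) (attach (Suc n) (c, None))) = Suc (card (roots n c))"
    and "s \<in> free_slots r n c \<Longrightarrow> card (roots (Suc n) (attach (Suc n) (c, Some s))) = card (roots n c)"
proof -
  have no: "c u i \<noteq> Some (Suc n)" for u i using slot_mapsD(3)[OF c, of u i "Suc n"] by auto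
  have "roots (Suc n) (attach (Suc n) (c, None)) = insert (Suc n) (roots n c)"
    using no by (auto simp: roots_def attach_def le_Suc_eq)
  moreover have "Suc n \<notin> roots n c" "finite (roots n c)" by (auto simp: roots_def)
  ultimately show "card (roots (Suc n) (attach (Suc n) (c, None))) = Suc (card (roots n c))"
    by simp
  assume "s \<in> free_slots r n c"
  then have s: "c (fst s) (snd s) = None" by (auto simp: free_slots_def)
  have "attach (Suc n) (c, Some s) u i = Some v \<longleftrightarrow> c u i = Some v" if "v \<noteq> Suc n" for u i v
    using that s by (auto simp: attach_def)
  moreover have "attach (Suc n) (c, Some s) (fst s) (snd s) = Some (Suc n)"
    by (simp add: attach_def)
  ultimately have "roots (Suc n) (attach (Suc n) (c, Some s)) = roots n c"
    unfolding roots_def by (auto simp: le_Suc_eq)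
  then show "card (roots (Suc n) (attach (Suc n) (c, Some s))) = card (roots n c)" by simp
qed

section \<open>Slot maps describe increasing forests\<close>

text \<open>A path from a root never needs to go up: a step up from a vertex reached downwards leads to its
  only parent, which has been reached before.\<close>

lemma rtrancl_sym_root:
  assumes uniq: "\<And>u u' v. (u, v) \<in> R \<Longrightarrow> (u', v) \<in> R \<Longrightarrow> u = u'"
    and root: "\<nexists>u. (u, \<rho>) \<in> R"
  shows "(\<rho>, v) \<in> (R \<union> R\<inverse>)\<^sup>* \<longleftrightarrow> (\<rho>, v) \<in> R\<^sup>*"
proof
  assume "(\<rho>, v) \<in> (R \<union> R\<inverse>)\<^sup>*"
  then show "(\<rho>, v) \<in> R\<^sup>*"
  proof (induction rule: rtrancl_induct)
    case (step v w)
    show ?case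
    proof (cases "(v, w) \<in> R")
      case True
      then show ?thesis using step.IH by simp
    next
      case False
      then have "(w, v) \<in> R" using step.hyps by auto
      with step.IH root uniq show ?thesis by (metis rtranclE)
    qed
  qed simp
next
  show "(\<rho>, v) \<in> R\<^sup>* \<Longrightarrow> (\<rho>, v) \<in> (R \<union> R\<inverse>)\<^sup>*" by (rule rtrancl_mono[THEN subsetD]) auto
qed

lemma rtrancl_path:
  assumes "(u, v) \<in> R\<^sup>*"
  obtains p where "p \<noteq> []" "hd p = u" "last p = v" "successively (\<lambda>a b. (a, b) \<in> R) p"
  using assms
proof (induction arbitrary: thesis rule: rtrancl_induct)
  case base
  then show ?case using base[of "[u]"] by simp
next
  case (step y z)
  obtain p where "p \<noteq> []" "hd p = u" "last p = y" "successively (\<lambda>a b. (a, b) \<in> R) p"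
    using step.IH by blast
  then show ?case using step.hyps by (intro step.prems[of "p @ [z]"]) (auto simp: successively_append_iff)
qed

definition forest_of :: "nat \<Rightarrow> (nat \<Rightarrow> nat \<Rightarrow> nat option) \<Rightarrow> nat forest" where
  "forest_of n c = \<lparr>fverts = {1..n}, fchild = c\<rparr>"

lemma component_equiv:
  "equiv (fverts F) {(u, v). u \<in> fverts F \<and> v \<in> fverts F \<and> (u, v) \<in> (child_rel F \<union> (child_rel F)\<inverse>)\<^sup>*}"
proof (rule equivI)
  have "sym ((child_rel F \<union> (child_rel F)\<inverse>)\<^sup>*)"
    by (rule sym_rtrancl) (auto simp: sym_def)
  then show "sym {(u, v). u \<in> fverts F \<and> v \<in> fverts F \<and> (u, v) \<in> (child_rel F \<union> (child_rel F)\<inverse>)\<^sup>*}"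
    by (auto simp: sym_def)
qed (auto simp: refl_on_def trans_def)

lemma rooted_treeD:
  assumes "rooted_tree V R \<rho>"
  shows "v \<in> V \<Longrightarrow> (\<rho>, v) \<in> R\<^sup>*" and "(u, \<rho>) \<notin> R"
    and "v \<in> V \<Longrightarrow> v \<noteq> \<rho> \<Longrightarrow> \<exists>!u. (u, v) \<in> R"
  using assms unfolding rooted_tree_def by blast+

text \<open>If \<open>v\<close> has a parent, it is not the root of its component, so the parent is unique. The path from the
  root to the parent, continued to \<open>v\<close>, is increasing.\<close>

lemma increasing_forest_slot_map:
  assumes F: "increasing_forest r n F"
  shows "fchild F \<in> slot_maps r n"
proof -
  let ?R = "child_rel F"
  have V: "fverts F = {1..n}" and sub: "?R \<subseteq> {1..n} \<times> {1..n}"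
    and dom: "\<And>u. dom (fchild F u) \<subseteq> {1..r}"
    and inj: "\<And>u. inj_on (fchild F u) (dom (fchild F u))"
    and tree: "\<And>C. C \<in> components F \<Longrightarrow> \<exists>\<rho>. component_root F C \<rho>"
    and incr: "\<And>p C. C \<in> components F \<Longrightarrow> p \<noteq> [] \<Longrightarrow> component_root F C (hd p) \<Longrightarrow>
        successively (\<lambda>u v. (u, v) \<in> ?R) p \<Longrightarrow> sorted_wrt (<) p"
    using F unfolding increasing_forest_def rary_forest_def by (simp_all, blast+)
  let ?E = "{(u, v). u \<in> fverts F \<and> v \<in> fverts F \<and> (u, v) \<in> (?R \<union> ?R\<inverse>)\<^sup>*}"
  have parent: "u < v \<and> (\<forall>u'. (u', v) \<in> ?R \<longrightarrow> u' = u)" if uv: "(u, v) \<in> ?R" for u v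
  proof -
    let ?C = "?E `` {v}"
    have v: "v \<in> fverts F" using uv sub V by auto
    have C: "?C \<in> components F" unfolding components_def using v by (rule quotientI)
    have vC: "v \<in> ?C" using v by simp
    have pC: "u' \<in> ?C" if "(u', v) \<in> ?R" for u' using that sub V by auto
    obtain \<rho> where \<rho>: "component_root F ?C \<rho>" using tree[OF C] by blast
    let ?S = "?R \<inter> ?C \<times> ?C"
    have t: "rooted_tree ?C ?S \<rho>" using \<rho> by (simp only: component_root_def)
    have uS: "(u', v) \<in> ?S" if "(u', v) \<in> ?R" for u' using that pC vC by blast
    have "v \<noteq> \<rho>" using rooted_treeD(2)[OF t] uS[OF uv] by blast
    then have "\<exists>!u. (u, v) \<in> ?S" by (rule rooted_treeD(3)[OF t vC])
    then have uq: "\<forall>u'. (u', v) \<in> ?R \<longrightarrow> u' = u" using uS uv by blast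
    have "(\<rho>, u) \<in> ?S\<^sup>*" by (rule rooted_treeD(1)[OF t pC[OF uv]])
    then have "(\<rho>, u) \<in> ?R\<^sup>*" by (rule rtrancl_mono[THEN subsetD, rotated]) auto
    then obtain p where p: "p \<noteq> []" "hd p = \<rho>" "last p = u" "successively (\<lambda>a b. (a, b) \<in> ?R) p"
      by (rule rtrancl_path)
    have "sorted_wrt (<) (p @ [v])"
      by (rule incr[OF C]) (use p uv \<rho> in \<open>auto simp: successively_append_iff\<close>)
    then have "u < v" using p by (auto simp: sorted_wrt_append)
    then show ?thesis using uq by blast
  qed
  have R: "(u, v) \<in> ?R" if "fchild F u i = Some v" for u i v using that by (auto simp: child_rel_def)
  show ?thesis
    unfolding slot_maps_def
  proof (intro CollectI conjI allI impI)
    fix u i v assume e: "fchild F u i = Some v"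
    show "1 \<le> u" "u < v" "v \<le> n" using R[OF e] sub parent by auto
    show "1 \<le> i" "i \<le> r" using dom[of u] e by (auto dest: domI)
  next
    fix u i u' i' v assume e: "fchild F u i = Some v" "fchild F u' i' = Some v"
    show u: "u = u'" using R[OF e(1)] R[OF e(2)] parent by blast
    show "i = i'" using e u inj[of u] by (auto simp: inj_on_def dom_def)
  qed
qed

definition descendants :: "nat forest \<Rightarrow> nat \<Rightarrow> nat set" where
  "descendants F \<rho> = {v. (\<rho>, v) \<in> (child_rel F)\<^sup>*}"

context
  fixes r n c F
  assumes c: "c \<in> slot_maps r n" and F_def: "F = forest_of n c"
begin

lemma child_rel_slot_map:
  assumes "(u, v) \<in> child_rel F"
  shows "u \<in> {1..n}" "v \<in> {1..n}" "u < v" "(u', v) \<in> child_rel F \<Longrightarrow> u' = u"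
proof -
  have rel: "(u, v) \<in> child_rel F \<longleftrightarrow> (\<exists>i. c u i = Some v)" for u v
    by (simp add: child_rel_def F_def forest_of_def)
  then obtain i where i: "c u i = Some v" using assms by blast
  show "u \<in> {1..n}" "v \<in> {1..n}" "u < v" using slot_mapsD[OF c i] by auto
  show "u' = u" if "(u', v) \<in> child_rel F" using that rel slot_maps_inj[OF c _ i] by blast
qed

lemma no_parent_roots: "\<rho> \<in> roots n c \<longleftrightarrow> \<rho> \<in> {1..n} \<and> (\<nexists>u. (u, \<rho>) \<in> child_rel F)"
  by (auto simp: roots_def child_rel_def F_def forest_of_def)

lemma descendants_subset:
  assumes "\<rho> \<in> roots n c"
  shows "descendants F \<rho> \<subseteq> {1..n}"
proof
  fix v assume "v \<in> descendants F \<rho>"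
  then have "(\<rho>, v) \<in> (child_rel F)\<^sup>*" by (simp add: descendants_def)
  then show "v \<in> {1..n}"
    by (cases rule: rtranclE) (use assms no_parent_roots child_rel_slot_map(2) in blast)+
qed

lemma exists_root:
  assumes "v \<in> {1..n}"
  shows "\<exists>\<rho>\<in>roots n c. v \<in> descendants F \<rho>"
  using assms
proof (induction v rule: less_induct)
  case (less v)
  show ?case
  proof (cases "\<exists>u. (u, v) \<in> child_rel F")
    case True
    then obtain u where u: "(u, v) \<in> child_rel F" by blast
    then obtain \<rho> where "\<rho> \<in> roots n c" "(\<rho>, u) \<in> (child_rel F)\<^sup>*"
      using less.IH[of u] child_rel_slot_map(1,3)[OF u] by (auto simp: descendants_def)
    then show ?thesis using u by (auto simp: descendants_def intro: rtrancl_into_rtrancl)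
  next
    case False
    then show ?thesis using less.prems by (auto simp: no_parent_roots descendants_def)
  qed
qed

text \<open>Each component is the set of descendants of its root, and therefore components are counted by
  roots.\<close>

lemma components_slot_map: "components F = descendants F ` roots n c"
proof -
  let ?R = "child_rel F"
  let ?E = "{(u, v). u \<in> fverts F \<and> v \<in> fverts F \<and> (u, v) \<in> (?R \<union> ?R\<inverse>)\<^sup>*}"
  have V: "fverts F = {1..n}" by (simp add: F_def forest_of_def)
  have cls: "?E `` {\<rho>} = descendants F \<rho>" if "\<rho> \<in> roots n c" for \<rho>
  proof -
    have "(\<rho>, v) \<in> (?R \<union> ?R\<inverse>)\<^sup>* \<longleftrightarrow> (\<rho>, v) \<in> ?R\<^sup>*" for v
      using rtrancl_sym_root[of ?R \<rho> v] child_rel_slot_map(4) that no_parent_roots by blast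
    then show ?thesis
      using that descendants_subset[OF that] by (auto simp: V descendants_def no_parent_roots)
  qed
  have "\<exists>\<rho>\<in>roots n c. ?E `` {v} = descendants F \<rho>" if v: "v \<in> {1..n}" for v
  proof -
    obtain \<rho> where \<rho>: "\<rho> \<in> roots n c" "v \<in> descendants F \<rho>" using exists_root[OF v] by blast
    then have "(\<rho>, v) \<in> ?E" using cls[OF \<rho>(1)] by (simp only: Image_singleton_iff[symmetric])
    then have "?E `` {\<rho>} = ?E `` {v}" by (rule equiv_class_eq[OF component_equiv])
    then have "?E `` {v} = descendants F \<rho>" using cls[OF \<rho>(1)] by simp
    then show ?thesis using \<rho>(1) by (rule bexI)
  qed
  then have "components F \<subseteq> descendants F ` roots n c"
    unfolding components_def V by (blast elim!: quotientE)
  moreover have "descendants F \<rho> \<in> components F" if "\<rho> \<in> roots n c" for \<rho>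
  proof -
    have "\<rho> \<in> fverts F" using that by (simp add: roots_def V)
    then show ?thesis unfolding components_def cls[OF that, symmetric] by (rule quotientI)
  qed
  ultimately show ?thesis by blast
qed

lemma inj_on_descendants: "inj_on (descendants F) (roots n c)"
proof (rule inj_onI)
  fix \<rho> \<sigma> assume a: "\<rho> \<in> roots n c" "\<sigma> \<in> roots n c" "descendants F \<rho> = descendants F \<sigma>"
  then have "(\<sigma>, \<rho>) \<in> (child_rel F)\<^sup>*" by (auto simp: descendants_def)
  then show "\<rho> = \<sigma>" using a(1) by (auto simp: no_parent_roots elim: rtranclE)
qed

lemma card_components_slot_map: "card (components F) = card (roots n c)"
  by (simp add: components_slot_map card_image inj_on_descendants)

lemma component_root_descendants:
  assumes \<rho>: "\<rho> \<in> roots n c"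
  shows "component_root F (descendants F \<rho>) \<rho>"
proof -
  let ?R = "child_rel F" and ?C = "descendants F \<rho>"
  have parent: "u \<in> ?C" if uv: "(u, v) \<in> ?R" and v: "v \<in> ?C" for u v
  proof -
    have "(\<rho>, v) \<in> ?R\<^sup>*" "v \<noteq> \<rho>" using uv v \<rho> by (auto simp: descendants_def no_parent_roots)
    then obtain w where "(\<rho>, w) \<in> ?R\<^sup>*" "(w, v) \<in> ?R" by (auto elim: rtranclE)
    then show ?thesis using child_rel_slot_map(4)[OF uv] by (auto simp: descendants_def)
  qed
  have "(\<rho>, v) \<in> (?R \<inter> ?C \<times> ?C)\<^sup>*" if "(\<rho>, v) \<in> ?R\<^sup>*" for v
    using that
  proof (induction rule: rtrancl_induct)
    case (step v w)
    then have "(v, w) \<in> ?R \<inter> ?C \<times> ?C"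
      by (auto simp: descendants_def intro: rtrancl_into_rtrancl)
    then show ?case using step.IH by (rule rtrancl_into_rtrancl[rotated])
  qed simp
  moreover have "\<exists>!u. (u, v) \<in> ?R \<inter> ?C \<times> ?C" if "v \<in> ?C - {\<rho>}" for v
  proof -
    have "(\<rho>, v) \<in> ?R\<^sup>*" "v \<noteq> \<rho>" using that by (auto simp: descendants_def)
    then obtain u where u: "(u, v) \<in> ?R" by (metis rtranclE)
    then show ?thesis using that parent child_rel_slot_map(4)[OF u] by blast
  qed
  moreover have "finite ?C" using descendants_subset[OF \<rho>] finite_subset by blast
  ultimately show ?thesis
    using \<rho> unfolding component_root_def rooted_tree_def
    by (auto simp: descendants_def no_parent_roots)
qed

lemma increasing_forest_of: "increasing_forest r n F"
proof -
  have V: "fverts F = {1..n}" by (simp add: F_def forest_of_def)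
  have "sorted_wrt (<) p" if "successively (\<lambda>u v. (u, v) \<in> child_rel F) p" for p
  proof -
    have "successively (<) p"
      using that by (rule successively_mono) (auto dest: child_rel_slot_map)
    then show ?thesis by (simp add: successively_iff_sorted_wrt_strong)
  qed
  moreover have "child_rel F \<subseteq> {1..n} \<times> {1..n}" using child_rel_slot_map by auto
  moreover have "dom (fchild F u) \<subseteq> {1..r}" for u
    using slot_mapsD[OF c] by (fastforce simp: F_def forest_of_def)
  moreover have "inj_on (fchild F u) (dom (fchild F u))" for u
    using slot_maps_inj[OF c] by (fastforce simp: F_def forest_of_def inj_on_def)
  ultimately show ?thesis
    unfolding increasing_forest_def rary_forest_def V components_slot_map
    using component_root_descendants by blast
qed

end

lemma increasing_forests_eq:
  "increasing_forests r n k = forest_of n ` {c \<in> slot_maps r n. card (roots n c) = k}"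
proof (intro equalityI subsetI)
  fix F assume F: "F \<in> increasing_forests r n k"
  then have c: "fchild F \<in> slot_maps r n" and V: "fverts F = {1..n}"
    using increasing_forest_slot_map by (auto simp: increasing_forests_def increasing_forest_def)
  have e: "F = forest_of n (fchild F)" using V by (simp add: forest_of_def)
  then show "F \<in> forest_of n ` {c \<in> slot_maps r n. card (roots n c) = k}"
    using c F card_components_slot_map[OF c e] by (auto simp: increasing_forests_def)
next
  fix F assume "F \<in> forest_of n ` {c \<in> slot_maps r n. card (roots n c) = k}"
  then show "F \<in> increasing_forests r n k"
    using increasing_forest_of card_components_slot_map by (fastforce simp: increasing_forests_def)
qed

lemma card_increasing_forests:
  "card (increasing_forests r n k) = card {c \<in> slot_maps r n. card (roots n c) = k}"
  unfolding increasing_forests_eq by (intro card_image inj_onI) (simp add: forest_of_def)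

section \<open>The recurrence for forests\<close>

definition forest_seq :: "nat \<Rightarrow> nat \<Rightarrow> nat \<Rightarrow> int" where
  "forest_seq r n = count_by (slot_maps r n) (\<lambda>c. card (roots n c))"

lemma forest_seq_eq: "forest_seq r n k = int (card (increasing_forests r n k))"
  by (simp add: forest_seq_def count_by_def card_increasing_forests)

lemma forest_seq_0: "forest_seq r 0 = unit_seq"
  by (rule ext) (simp add: forest_seq_def count_by_def slot_maps_0 roots_def unit_seq_def
      Collect_conv_if)

lemma forest_seq_Suc: "forest_seq r (Suc n) = extend_op (- ((int r - 1) * int n)) (forest_seq r n)"
  unfolding forest_seq_def
  by (rule count_extension_extend_op[OF bij_betw_attach finite_slot_maps finite_free_slots])
    (simp_all add: card_roots_attach card_free_slots)

section \<open>Stirling numbers and forests\<close>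

text \<open>The parameter \<open>-(r - 1) * n\<close> in the recurrence for forests is cancelled exactly by moving it
  past a shift by \<open>(r - 1) * n\<close>, which leaves \<open>T\<^sub>0\<close>.\<close>

lemma shifted_forest_seq:
  assumes r: "r \<ge> 1" and zero: "g 0 = unit_seq"
    and step: "\<And>n. g (Suc n) = (shift ^^ (r - 1)) (extend_op 0 (g n))"
  shows "g n = (shift ^^ ((r - 1) * n)) (forest_seq r n)"
proof (induction n)
  case 0
  then show ?case by (simp add: zero forest_seq_0)
next
  case (Suc n)
  let ?m = "(r - 1) * n"
  have m: "(int r - 1) * int n = int ?m" using r by (simp add: of_nat_diff)
  have "(shift ^^ ?m) (forest_seq r (Suc n)) = extend_op 0 ((shift ^^ ?m) (forest_seq r n))"
    using shift_pow_extend_op[of ?m "- int ?m" "forest_seq r n"] by (simp only: forest_seq_Suc m) simp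
  then have "g (Suc n) = (shift ^^ (r - 1)) ((shift ^^ ?m) (forest_seq r (Suc n)))"
    by (simp only: step Suc.IH)
  also have "\<dots> = (shift ^^ ((r - 1) + ?m)) (forest_seq r (Suc n))"
    by (simp only: funpow_add o_apply)
  finally show ?case by (simp only: mult_Suc_right)
qed

theorem mainTheorem7:
  fixes n r k :: nat
  assumes "n \<ge> 1" and "r \<ge> 1"
  shows "graph_stirling (graph_G n r) (k + (r - 1) * n) = card (increasing_forests r n k) \<and>
         graph_stirling (graph_H n r) (k + (r - 1) * n) = card (increasing_forests r n k)"
proof -
  have G: "stirling_seq (graph_G n r) = (shift ^^ ((r - 1) * n)) (forest_seq r n)"
    by (rule shifted_forest_seq[where g = "\<lambda>n. stirling_seq (graph_G n r)",
          OF \<open>r \<ge> 1\<close> _ stirling_seq_graph_G_Suc[OF \<open>r \<ge> 1\<close>]])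
      (simp add: stirling_seq_empty graph_G_def empty_graph_def)
  have H: "stirling_seq (graph_H n r) = (shift ^^ ((r - 1) * n)) (forest_seq r n)"
    by (rule shifted_forest_seq[where g = "\<lambda>n. stirling_seq (graph_H n r)",
          OF \<open>r \<ge> 1\<close> _ stirling_seq_graph_H_Suc[OF \<open>r \<ge> 1\<close>]])
      (simp add: stirling_seq_empty graph_H_def)
  have "int (graph_stirling (graph_G n r) (k + (r - 1) * n)) = int (card (increasing_forests r n k))"
    by (simp only: stirling_seq_eq[symmetric] G shift_pow_apply forest_seq_eq)
  moreover have "int (graph_stirling (graph_H n r) (k + (r - 1) * n)) =
      int (card (increasing_forests r n k))"
    by (simp only: stirling_seq_eq[symmetric] H shift_pow_apply forest_seq_eq)
  ultimately show ?thesis by simp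
qed

end
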